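(* Let $\Gamma$ be a finite, connected, simple, undirected graph with at least one edge, $G$ a group, and $s_2\in Z(G)$ with $s_2^2=1_G$. For $H_1,H_2\in\mathcal H_\Gamma$, one has $H_1\sim_l H_2$ if and only if $\Psi_L(H_1)=\Psi_L(H_2)$. That is, the orbits of the action $l$ on $\mathcal H_\Gamma$ are exactly the fibers of $\Psi_L$.
   Context: Fix orders $V_\Gamma=\{v_1,\dots,v_n\}$, $E_\Gamma=\{e_1,\dots,e_m\}$; write $v_i\in e_j$ if $v_i$ is an endpoint of $e_j$, and $e_i\cap e_j$ for the common endpoint of distinct edges sharing a vertex. $\mathbb CG$ is the complex group algebra with involution $(\sum f_xx)^*=\sum\overline{f_x}x^{-1}$, and $(A^* )_{i,j}=(A_{j,i})^*$ for matrices over it. A $G$-phase of $\Gamma$ is $H\in M_{n\times m}(\mathbb CG)$ with $H_{i,j}\in G$ if $v_i\in e_j$ and $H_{i,j}=0$ otherwise; $\mathcal H_\Gamma$ is their set. For $f\in G^n$, $\underline f=\mathrm{diag}(f_1,\dots,f_n)$; the action $l$ of $G^n$ on $\mathcal H_\Gamma$ is $l(f,H)=\underline f^{\,*}H$, and $H_1\sim_l H_2$ means $H_1=\underline f^{\,*}H_2$ for some $f\in G^n$. The line graph $L(\Gamma)$ has vertex set $E_\Gamma$, with $e_i\sim e_j$ iff they share an endpoint. $\Psi_L(H)$ is the $G$-gain function on $L(\Gamma)$ given by $\Psi_L(H)(e_i,e_j)=s_2H_{k,i}^{-1}H_{k,j}$ where $v_k=e_i\cap e_j$. *)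

theory Defs
  imports
    Complex_Main
    "HOL-Library.Poly_Mapping"
    "HOL-Library.FuncSet"
    "Graph_Theory.Digraph_Component"
    "Jordan_Normal_Form.Matrix"
begin

section \<open>The group algebra and its matrices\<close>

text \<open>
  The group \<open>G\<close> is a type of class \<open>group_add\<close>. Despite its additive notation this class is not
  commutative: \<open>g + h\<close>, \<open>0\<close> and \<open>- g\<close> stand for the product \<open>gh\<close>, the unit and the inverse of \<open>g\<close>.
  The finitely supported functions \<open>'g \<Rightarrow>\<^sub>0 complex\<close> carry the convolution product, so they are
  the group algebra over the complex numbers.
\<close>

type_synonym 'g group_algebra = "'g \<Rightarrow>\<^sub>0 complex"

definition group_center :: "'g::group_add set" where
  "group_center = {z. \<forall>g. z + g = g + z}"

definition of_group :: "'g \<Rightarrow> 'g group_algebra" where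
  "of_group g = Poly_Mapping.single g 1"

text \<open>Only meaningful on \<open>range of_group\<close>, the copy of \<open>G\<close> inside the group algebra.\<close>

definition to_group :: "'g group_algebra \<Rightarrow> 'g" where
  "to_group = the_inv of_group"

definition star :: "'g::group_add group_algebra \<Rightarrow> 'g group_algebra" where
  "star a = (\<Sum>x\<in>Poly_Mapping.keys a.
     Poly_Mapping.single (- x) (cnj (Poly_Mapping.lookup a x)))"

definition mat_star :: "'g::group_add group_algebra mat \<Rightarrow> 'g group_algebra mat" where
  "mat_star A = mat (dim_col A) (dim_row A) (\<lambda>(i, j). star (A $$ (j, i)))"


section \<open>Graphs, line graphs and gain functions\<close>

text \<open>
  Simple undirected graphs are the symmetric loop-free digraphs of \<^locale>\<open>pair_graph\<close>, and gain
  functions live on their arcs. The undirected edges are the sets \<open>{u, v}\<close> for an arc \<open>(u, v)\<close>.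
\<close>

definition edges :: "'v pair_pre_digraph \<Rightarrow> 'v set set" where
  "edges \<Gamma> = {{u, v} | u v. (u, v) \<in> parcs \<Gamma>}"

definition line_graph :: "'v pair_pre_digraph \<Rightarrow> 'v set pair_pre_digraph" where
  "line_graph \<Gamma> = \<lparr> pverts = edges \<Gamma>,
     parcs = {(e, e'). e \<in> edges \<Gamma> \<and> e' \<in> edges \<Gamma> \<and> e \<noteq> e' \<and> e \<inter> e' \<noteq> {}} \<rparr>"

text \<open>
  Gain functions are normalised to \<open>undefined\<close> on pairs that are not arcs, so that HOL equality is
  equality as functions on the arcs.
\<close>

definition gain_functions :: "'v pair_pre_digraph \<Rightarrow> ('v \<times> 'v \<Rightarrow> 'g::group_add) set" where
  "gain_functions \<Lambda> =
     {\<psi> \<in> extensional (parcs \<Lambda>). \<forall>(u, v)\<in>parcs \<Lambda>. \<psi> (v, u) = - \<psi> (u, v)}"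


section \<open>Phases\<close>

text \<open>
  The orders on vertices and edges are given by lists \<open>vs\<close>, \<open>es\<close> without repetitions; indices
  start at 0.
\<close>

definition phases :: "'v list \<Rightarrow> 'v set list \<Rightarrow> 'g::group_add group_algebra mat set" where
  "phases vs es = {H \<in> carrier_mat (length vs) (length es).
     \<forall>i<length vs. \<forall>j<length es.
       (vs ! i \<in> es ! j \<longrightarrow> H $$ (i, j) \<in> range of_group) \<and>
       (vs ! i \<notin> es ! j \<longrightarrow> H $$ (i, j) = 0)}"

definition diag_of_group :: "'g::group_add vec \<Rightarrow> 'g group_algebra mat" where
  "diag_of_group f = mat_diag (dim_vec f) (\<lambda>i. of_group (f $ i))"

definition phase_act ::
    "'g::group_add vec \<Rightarrow> 'g group_algebra mat \<Rightarrow> 'g group_algebra mat" where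
  "phase_act f H = mat_star (diag_of_group f) * H"

definition phase_equiv ::
    "nat \<Rightarrow> 'g::group_add group_algebra mat \<Rightarrow> 'g group_algebra mat \<Rightarrow> bool" where
  "phase_equiv n H1 H2 \<longleftrightarrow> (\<exists>f\<in>carrier_vec n. H1 = phase_act f H2)"

definition phase_orbit ::
    "nat \<Rightarrow> 'g::group_add group_algebra mat \<Rightarrow> 'g group_algebra mat set" where
  "phase_orbit n H = (\<lambda>f. phase_act f H) ` carrier_vec n"

definition position :: "'a list \<Rightarrow> 'a \<Rightarrow> nat" where
  "position xs x = (THE i. i < length xs \<and> xs ! i = x)"

definition common_endpoint :: "'v set \<Rightarrow> 'v set \<Rightarrow> 'v" where
  "common_endpoint e e' = (THE v. e \<inter> e' = {v})"

definition Psi_L :: "'v pair_pre_digraph \<Rightarrow> 'v list \<Rightarrow> 'v set list \<Rightarrow> 'g::group_add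
    \<Rightarrow> 'g group_algebra mat \<Rightarrow> 'v set \<times> 'v set \<Rightarrow> 'g" where
  "Psi_L \<Gamma> vs es s H = (\<lambda>(e, e')\<in>parcs (line_graph \<Gamma>).
     let k = position vs (common_endpoint e e'); i = position es e; j = position es e'
     in s + - to_group (H $$ (k, i)) + to_group (H $$ (k, j)))"


section \<open>Well-definedness\<close>

lemma to_group_of_group [simp]: "to_group (of_group g) = g"
proof -
  have "inj (of_group :: 'g \<Rightarrow> 'g group_algebra)"
    unfolding of_group_def
    by (rule injI) (metis lookup_single_eq lookup_single_not_eq zero_neq_one)
  then show ?thesis
    unfolding to_group_def by (rule the_inv_f_f)
qed

lemma star_of_group [simp]: "star (of_group g) = of_group (- g)"
  by (simp add: star_def of_group_def)

lemma of_group_mult: "of_group g * of_group h = of_group (g + h)"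
  by (simp add: of_group_def mult_single)

lemma star_zero [simp]: "star 0 = 0"
  by (simp add: star_def)

lemma mat_star_diag_of_group:
  "mat_star (diag_of_group f) = mat_diag (dim_vec f) (\<lambda>i. of_group (- (f $ i)))"
  by (rule eq_matI) (auto simp: mat_star_def diag_of_group_def mat_diag_def)

lemma phase_act_in_phases:
  assumes "H \<in> phases vs es" and "f \<in> carrier_vec (length vs)"
  shows "phase_act f H \<in> phases vs es"
proof -
  have "phase_act f H = mat (length vs) (length es) (\<lambda>(i, j). of_group (- (f $ i)) * H $$ (i, j))"
    using assms unfolding phase_act_def mat_star_diag_of_group
    by (subst mat_diag_mult_left) (auto simp: phases_def)
  moreover have "of_group g * x \<in> range of_group"
    if "x \<in> range of_group" for g :: 'a and x
    using that by (auto simp: of_group_mult)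
  ultimately show ?thesis
    using assms(1) by (simp add: phases_def)
qed

lemma Psi_L_gain_function:
  assumes "s \<in> group_center" and "s + s = 0"
  shows "Psi_L \<Gamma> vs es s H \<in> gain_functions (line_graph \<Gamma>)"
proof -
  have inv: "- s = s"
    using assms(2) by (simp add: minus_unique)
  have cen: "g + s = s + g" for g
    using assms(1) by (simp add: group_center_def)
  have gain: "s + - b + a = - (s + - a + b)" for a b
  proof -
    have "- (s + - a + b) = (- b + a) + s"
      by (simp only: minus_add minus_minus inv add.assoc)
    also have "\<dots> = s + - b + a"
      by (simp only: cen add.assoc)
    finally show ?thesis by simp
  qed
  have Psi: "Psi_L \<Gamma> vs es s H (e', e) = - Psi_L \<Gamma> vs es s H (e, e')"
    if "(e, e') \<in> parcs (line_graph \<Gamma>)" for e e'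
  proof -
    have "common_endpoint e' e = common_endpoint e e'"
      by (simp add: common_endpoint_def Int_commute)
    moreover have "(e', e) \<in> parcs (line_graph \<Gamma>)"
      using that by (auto simp: line_graph_def)
    ultimately show ?thesis
      using that by (simp only: Psi_L_def Let_def restrict_apply if_True prod.case) (rule gain)
  qed
  have "Psi_L \<Gamma> vs es s H \<in> extensional (parcs (line_graph \<Gamma>))"
    unfolding Psi_L_def by (rule restrict_extensional)
  with Psi show ?thesis
    unfolding gain_functions_def by blast
qed

end

theory Submission
  imports Defs
begin

text \<open>
  The gain of a pair of edges meeting in \<open>v\<^sub>i\<close> involves only row \<open>i\<close> of \<open>H\<close>, through the quotients
  \<open>H\<^sub>i\<^sub>j\<inverse> H\<^sub>i\<^sub>k\<close>. These are all the invariants of that row under left multiplication by a group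
  element, so two phases with the same gains differ row by row by such a multiplication.
\<close>

lemma position_nth:
  assumes "distinct xs" and "i < length xs"
  shows "position xs (xs ! i) = i"
  unfolding position_def using assms by (intro the_equality) (auto simp: nth_eq_iff_index_eq)

text \<open>An edge has at most two elements, so two different edges cannot share two
  vertices.\<close>

lemma common_endpoint_eqI:
  assumes "e \<in> edges \<Gamma>" and "e' \<in> edges \<Gamma>" and "e \<noteq> e'" and "v \<in> e" and "v \<in> e'"
  shows "common_endpoint e e' = v"
proof -
  have "e \<inter> e' = {v}"
    using assms unfolding edges_def by blast
  then show ?thesis
    by (simp add: common_endpoint_def)
qed

lemma edge_subset_pverts:
  assumes "pair_wf_digraph \<Gamma>" and "e \<in> edges \<Gamma>"
  shows "e \<subseteq> pverts \<Gamma>"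
  using assms unfolding edges_def
  by (auto dest: pair_wf_digraph.in_arcsD1 pair_wf_digraph.in_arcsD2)

text \<open>This puts the gain into matrix coordinates: any row incident with both columns must be
  that of the common endpoint, and \<open>j \<noteq> k\<close> makes the pair an arc of the line
  graph.\<close>

lemma Psi_L_nth:
  assumes "distinct vs" and "distinct es" and "set es = edges \<Gamma>"
    and "i < length vs" and "j < length es" and "k < length es" and "j \<noteq> k"
    and "vs ! i \<in> es ! j" and "vs ! i \<in> es ! k"
  shows "Psi_L \<Gamma> vs es s H (es ! j, es ! k)
    = s + - to_group (H $$ (i, j)) + to_group (H $$ (i, k))"
proof -
  have edges: "es ! j \<in> edges \<Gamma>" "es ! k \<in> edges \<Gamma>" "es ! j \<noteq> es ! k"
    using assms by (auto simp: nth_eq_iff_index_eq simp flip: assms(3))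
  then have "(es ! j, es ! k) \<in> parcs (line_graph \<Gamma>)"
    using assms(8,9) by (auto simp: line_graph_def)
  moreover have "common_endpoint (es ! j) (es ! k) = vs ! i"
    using edges assms(8,9) by (rule common_endpoint_eqI)
  ultimately show ?thesis
    using assms by (simp add: Psi_L_def position_nth)
qed

text \<open>The factor \<open>s\<close> stands leftmost in every gain and cancels. What remains is a
  condition on the rows of the matrices, the same one that characterises \<open>phase_equiv\<close>
  below.\<close>

lemma Psi_L_eq_iff:
  fixes s :: "'g::group_add"
  assumes "distinct vs" and "distinct es" and "set es = edges \<Gamma>" and "\<Union> (edges \<Gamma>) \<subseteq> set vs"
  shows "Psi_L \<Gamma> vs es s H = Psi_L \<Gamma> vs es s H' \<longleftrightarrow>
    (\<forall>i<length vs. \<forall>j<length es. \<forall>k<length es. vs ! i \<in> es ! j \<longrightarrow> vs ! i \<in> es ! k \<longrightarrow>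
      - to_group (H $$ (i, j)) + to_group (H $$ (i, k))
      = - to_group (H' $$ (i, j)) + to_group (H' $$ (i, k)))"
    (is "?gains \<longleftrightarrow> ?quotients")
proof
  assume gains: ?gains
  show ?quotients
  proof (intro allI impI)
    fix i j k
    assume ijk: "i < length vs" "j < length es" "k < length es" "vs ! i \<in> es ! j" "vs ! i \<in> es ! k"
    show "- to_group (H $$ (i, j)) + to_group (H $$ (i, k))
      = - to_group (H' $$ (i, j)) + to_group (H' $$ (i, k))"
    \<comment> \<open>For \<open>j = k\<close> there is no arc to read a gain from, but both
      quotients are the unit.\<close>
    proof (cases "j = k")
      case False
      note nth = Psi_L_nth[OF assms(1-3) ijk(1-3) False ijk(4,5)]
      show ?thesis
        using fun_cong[OF gains, of "(es ! j, es ! k)"] unfolding nth add.assoc by simp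
    qed simp
  qed
next
  assume quotients: ?quotients
  have "Psi_L \<Gamma> vs es s H (e, e') = Psi_L \<Gamma> vs es s H' (e, e')" for e e'
  proof (cases "(e, e') \<in> parcs (line_graph \<Gamma>)")
    case True
    then obtain v where v: "v \<in> e" "v \<in> e'" and e: "e \<in> set es" "e' \<in> set es" "e \<noteq> e'"
      using assms(3) by (auto simp: line_graph_def)
    then obtain j k where jk: "j < length es" "e = es ! j" "k < length es" "e' = es ! k"
      by (metis in_set_conv_nth)
    \<comment> \<open>The shared vertex indexes a row because \<open>vs\<close> lists all
      endpoints.\<close>
    obtain i where i: "i < length vs" "v = vs ! i"
      using v e assms(3,4) by (metis UnionI in_set_conv_nth subsetD)
    from e jk have "j \<noteq> k"
      by blast
    note nth = Psi_L_nth[OF assms(1-3) i(1) jk(1,3) this v[unfolded i(2) jk]]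
    show ?thesis
      using quotients v i jk unfolding jk nth add.assoc by simp
  \<comment> \<open>Off the arcs both functions take the value \<open>undefined\<close>.\<close>
  qed (simp add: Psi_L_def)
  then show ?gains
    by auto
qed

lemma phase_act_index:
  assumes "H \<in> phases vs es" and "f \<in> carrier_vec (length vs)"
    and "i < length vs" and "j < length es"
  shows "phase_act f H $$ (i, j) = of_group (- (f $ i)) * H $$ (i, j)"
  using assms unfolding phase_act_def mat_star_diag_of_group
  by (subst mat_diag_mult_left) (auto simp: phases_def)

lemma of_group_to_group_phase:
  assumes "H \<in> phases vs es" and "i < length vs" and "j < length es" and "vs ! i \<in> es ! j"
  shows "of_group (to_group (H $$ (i, j))) = H $$ (i, j)"
proof -
  have "H $$ (i, j) \<in> range of_group"
    using assms by (simp add: phases_def)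
  then show ?thesis
    by auto
qed

lemma to_group_phase_act:
  assumes "H \<in> phases vs es" and "f \<in> carrier_vec (length vs)"
    and "i < length vs" and "j < length es" and "vs ! i \<in> es ! j"
  shows "to_group (phase_act f H $$ (i, j)) = - (f $ i) + to_group (H $$ (i, j))"
  by (metis assms of_group_mult of_group_to_group_phase phase_act_index to_group_of_group)

text \<open>Entries at non-incident positions are 0 in every phase, and at incident ones
  \<open>to_group\<close> loses no information.\<close>

lemma phase_eqI:
  assumes "H \<in> phases vs es" and "H' \<in> phases vs es"
    and "\<And>i j. i < length vs \<Longrightarrow> j < length es \<Longrightarrow> vs ! i \<in> es ! j
      \<Longrightarrow> to_group (H $$ (i, j)) = to_group (H' $$ (i, j))"
  shows "H = H'"
proof (rule eq_matI)
  fix i j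
  assume "i < dim_row H'" "j < dim_col H'"
  then have ij: "i < length vs" "j < length es"
    using assms(2) by (auto simp: phases_def)
  show "H $$ (i, j) = H' $$ (i, j)"
  proof (cases "vs ! i \<in> es ! j")
    case True
    then show ?thesis
      using assms ij by (metis of_group_to_group_phase)
  next
    case False
    then show ?thesis
      using assms(1,2) ij by (simp add: phases_def)
  qed
qed (use assms in \<open>auto simp: phases_def\<close>)

lemma phase_equiv_iff_quotients:
  fixes H H' :: "'g::group_add group_algebra mat"
  assumes "H \<in> phases vs es" and "H' \<in> phases vs es"
  shows "phase_equiv (length vs) H H' \<longleftrightarrow>
    (\<forall>i<length vs. \<forall>j<length es. \<forall>k<length es. vs ! i \<in> es ! j \<longrightarrow> vs ! i \<in> es ! k \<longrightarrow>
      - to_group (H $$ (i, j)) + to_group (H $$ (i, k))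
      = - to_group (H' $$ (i, j)) + to_group (H' $$ (i, k)))"
    (is "_ \<longleftrightarrow> ?quotients")
proof
  assume "phase_equiv (length vs) H H'"
  then obtain f where "f \<in> carrier_vec (length vs)" "H = phase_act f H'"
    by (auto simp: phase_equiv_def)
  \<comment> \<open>In each quotient the factor \<open>f $ i\<close> from the inverted entry meets
    its own inverse from the other entry and cancels.\<close>
  then show ?quotients
    using assms(2) by (simp add: to_group_phase_act minus_add add.assoc)
next
  assume quotients: ?quotients
  \<comment> \<open>A reference edge at each vertex. At an isolated vertex the choice is arbitrary,
    which is harmless since that row has no incident entries to compare.\<close>
  define j\<^sub>0 where "j\<^sub>0 i = (SOME j. j < length es \<and> vs ! i \<in> es ! j)" for i
  \<comment> \<open>The value of \<open>f $ i\<close> solves the equation between \<open>H\<close>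
    and \<open>phase_act f H'\<close> in the reference column.\<close>
  define f where "f = vec (length vs)
    (\<lambda>i. to_group (H' $$ (i, j\<^sub>0 i)) + - to_group (H $$ (i, j\<^sub>0 i)))"
  have f: "f \<in> carrier_vec (length vs)"
    by (simp add: f_def)
  have f_index: "f $ i = to_group (H' $$ (i, j\<^sub>0 i)) + - to_group (H $$ (i, j\<^sub>0 i))"
    if "i < length vs" for i
    using that by (simp add: f_def)
  have "H = phase_act f H'"
  proof (rule phase_eqI[OF assms(1) phase_act_in_phases[OF assms(2) f]])
    fix i j
    assume ij: "i < length vs" "j < length es" "vs ! i \<in> es ! j"
    then have "j\<^sub>0 i < length es \<and> vs ! i \<in> es ! j\<^sub>0 i"
      unfolding j\<^sub>0_def by (intro someI) blast
    then have quotient: "- to_group (H $$ (i, j\<^sub>0 i)) + to_group (H $$ (i, j))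
        = - to_group (H' $$ (i, j\<^sub>0 i)) + to_group (H' $$ (i, j))"
      using quotients ij by blast
    have "to_group (phase_act f H' $$ (i, j))
        = to_group (H $$ (i, j\<^sub>0 i)) + (- to_group (H' $$ (i, j\<^sub>0 i)) + to_group (H' $$ (i, j)))"
      using ij by (simp only: to_group_phase_act[OF assms(2) f] f_index
        minus_add minus_minus add.assoc)
    \<comment> \<open>The quotient of \<open>H'\<close> relative to the reference column is
      exchanged for that of \<open>H\<close>, whose reference entry then cancels.\<close>
    also have "\<dots> = to_group (H $$ (i, j))"
      by (simp only: quotient[symmetric] add_minus_cancel)
    finally show "to_group (H $$ (i, j)) = to_group (phase_act f H' $$ (i, j))" ..
  qed
  with f show "phase_equiv (length vs) H H'"
    by (auto simp: phase_equiv_def)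
qed

theorem theorem4p21:
  fixes \<Gamma> :: "'v pair_pre_digraph"
    and vs :: "'v list" and es :: "'v set list"
    and s\<^sub>2 :: "'g::group_add"
  assumes "pair_graph \<Gamma>" and "Digraph_Component.connected (with_proj \<Gamma>)" and "edges \<Gamma> \<noteq> {}"
    and "distinct vs" and "set vs = pverts \<Gamma>"
    and "distinct es" and "set es = edges \<Gamma>"
    and "s\<^sub>2 \<in> group_center" and "s\<^sub>2 + s\<^sub>2 = 0"
  shows "(\<forall>H\<^sub>1\<in>phases vs es. \<forall>H\<^sub>2\<in>phases vs es.
            phase_equiv (length vs) H\<^sub>1 H\<^sub>2
              \<longleftrightarrow> Psi_L \<Gamma> vs es s\<^sub>2 H\<^sub>1 = Psi_L \<Gamma> vs es s\<^sub>2 H\<^sub>2)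
       \<and> {phase_orbit (length vs) H | H. H \<in> phases vs es}
         = {{H \<in> phases vs es. Psi_L \<Gamma> vs es s\<^sub>2 H = \<psi>} | \<psi>. \<psi> \<in> Psi_L \<Gamma> vs es s\<^sub>2 ` phases vs es}"
proof -
  have "pair_wf_digraph \<Gamma>"
    using assms(1) by (simp add: pair_graph_def pair_digraph_def pair_fin_digraph_def)
  then have endpoints: "\<Union> (edges \<Gamma>) \<subseteq> set vs"
    using assms(5) edge_subset_pverts by blast
  have equiv_iff: "phase_equiv (length vs) H\<^sub>1 H\<^sub>2
      \<longleftrightarrow> Psi_L \<Gamma> vs es s\<^sub>2 H\<^sub>1 = Psi_L \<Gamma> vs es s\<^sub>2 H\<^sub>2"
    if "H\<^sub>1 \<in> phases vs es" "H\<^sub>2 \<in> phases vs es" for H\<^sub>1 H\<^sub>2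
    unfolding phase_equiv_iff_quotients[OF that] Psi_L_eq_iff[OF assms(4,6,7) endpoints] ..
  \<comment> \<open>The action preserves phases, so an orbit is a full equivalence class within
    \<open>phases vs es\<close>.\<close>
  have "phase_orbit (length vs) H = {H' \<in> phases vs es. phase_equiv (length vs) H' H}"
    if "H \<in> phases vs es" for H
    using that by (auto simp: phase_orbit_def phase_equiv_def intro: phase_act_in_phases)
  then have "phase_orbit (length vs) H
      = {H' \<in> phases vs es. Psi_L \<Gamma> vs es s\<^sub>2 H' = Psi_L \<Gamma> vs es s\<^sub>2 H}"
    if "H \<in> phases vs es" for H
    using that equiv_iff by blast
  \<comment> \<open>Each value in the image has the form
    \<open>Psi_L \<Gamma> vs es s\<^sub>2 H\<close>, so both families can be indexed by the phases
    \<open>H\<close>.\<close>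
  then have "{phase_orbit (length vs) H | H. H \<in> phases vs es}
      = {{H \<in> phases vs es. Psi_L \<Gamma> vs es s\<^sub>2 H = \<psi>} | \<psi>. \<psi> \<in> Psi_L \<Gamma> vs es s\<^sub>2 ` phases vs es}"
    by (simp add: Setcompr_eq_image image_image cong: image_cong)
  with equiv_iff show ?thesis
    by blast
qed

end
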